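(* For every standard formula $\alpha$ and all formulas $\phi,\psi$ of the team language, the formulas $\alpha\vee\alpha\to\alpha$ and $(\phi\to\alpha)\to((\psi\to\alpha)\to(\phi\vee\psi\to\alpha))$ are valid on every distributive general intuitionistic team Kripke frame.
   Context: **Language.** Fix a set $\mathsf{Prop}$ of propositional variables. Formulas of the team language are $\phi::=p\mid\bot\mid\phi\wedge\phi\mid\phi\vee\phi\mid\phi\veebar\phi\mid\phi\to\phi$; $\vee$ is the local and $\veebar$ the global disjunction; both bind more strongly than $\to$. Formulas without $\veebar$ are standard. **Frames.** For a nonempty set $W$ with a partial order $R$, teams are sets $t\subseteq W$; $R[t]=\{v\mid\exists w\in t:\ wRv\}$; and $tR^\circ s$ iff $\forall w\in t\,\exists v\in s\,(wRv)$ and $\forall v\in s\,\exists w\in t\,(wRv)$. A general intuitionistic team Kripke frame is $(W,R,\succcurlyeq,\Cup)$ where $W\neq\varnothing$, $R$ is a partial order on $W$, $\Cup$ is a binary operation on $\wp(W)$ such that $(\wp(W),\Cup,\varnothing)$ is a bounded join-semilattice ($\Cup$ associative, commutative, idempotent, $\varnothing\Cup t=t$), $\preccurlyeq$ is the induced partial order ($t\preccurlyeq s$ iff $t\Cup s=s$) with converse $\succcurlyeq$, and for all $t,s,s'\subseteq W$: - (a) if $tR^\circ s$ and $s\succcurlyeq s'$, then there is $t'\subseteq W$ with $t\succcurlyeq t'$ and $t'R^\circ s'$; - (b) $t\succcurlyeq\circ R^\circ s$ implies $R[t]\succcurlyeq s$, where $t\succcurlyeq\circ R^\circ s$ means there is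 $r\subseteq W$ with $t\succcurlyeq r$ and $rR^\circ s$; - (c) $R[t]\Cup R[s]=R[t\Cup s]$. The frame is distributive if for all $t,r,s\subseteq W$, $t\preccurlyeq r\Cup s$ implies that there are $r',s'\subseteq W$ with $r'\preccurlyeq r$, $s'\preccurlyeq s$ and $t=r'\Cup s'$. A model on the frame adds a valuation $V:\mathsf{Prop}\to\wp(W)$ persistent w.r.t. $R$ ($w\in V(p)$, $wRv$ imply $v\in V(p)$). **Generalized team semantics:** - $\mathfrak{M},t\models p$ iff $t\preccurlyeq V(p)$; - $\mathfrak{M},t\models\bot$ iff $t=\varnothing$; - $\mathfrak{M},t\models\phi\wedge\psi$ iff $\mathfrak{M},t\models\phi$ and $\mathfrak{M},t\models\psi$; - $\mathfrak{M},t\models\phi\vee\psi$ iff there are $s,r\subseteq W$ with $t\preccurlyeq s\Cup r$, $\mathfrak{M},s\models\phi$ and $\mathfrak{M},r\models\psi$; - $\mathfrak{M},t\models\phi\veebar\psi$ iff $\mathfrak{M},t\models\phi$ or $\mathfrak{M},t\models\psi$; - $\mathfrak{M},t\models\phi\to\psi$ iff for all $s\subseteq W$ with $t\succcurlyeq\circ R^\circ s$, $\mathfrak{M},s\models\phi$ implies $\mathfrak{M},s\models\psi$. A formula is valid on a frame if it holds at all teams in all models on the frame. *)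

theory Defs
  imports Main
begin

datatype 'p form =
    Atom 'p
  | Falsum
  | Conj "'p form" "'p form" (infixr "\<^bold>\<and>" 55)
  | LDisj "'p form" "'p form" (infixr "\<^bold>\<or>" 50)
  | GDisj "'p form" "'p form" (infixr "\<squnion>" 50)
  | Imp "'p form" "'p form" (infixr "\<^bold>\<rightarrow>" 45)

primrec standard :: "'p form \<Rightarrow> bool" where
  "standard (Atom p) \<longleftrightarrow> True"
| "standard Falsum \<longleftrightarrow> True"
| "standard (\<phi> \<^bold>\<and> \<psi>) \<longleftrightarrow> standard \<phi> \<and> standard \<psi>"
| "standard (\<phi> \<^bold>\<or> \<psi>) \<longleftrightarrow> standard \<phi> \<and> standard \<psi>"
| "standard (\<phi> \<squnion> \<psi>) \<longleftrightarrow> False"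
| "standard (\<phi> \<^bold>\<rightarrow> \<psi>) \<longleftrightarrow> standard \<phi> \<and> standard \<psi>"

text \<open>
  Throughout, \<open>W\<close> is the set of worlds, \<open>R\<close> the accessibility order, and \<open>J\<close> the join operation
  on teams; only the restriction of \<open>J\<close> to \<open>Pow W\<close> matters, so every quantifier over teams is
  bounded by \<open>W\<close>. The image \<open>R[t]\<close> is \<open>R `` t\<close>.
\<close>

text \<open>The lifting of \<open>R\<close> to teams, written \<open>R\<close> with a superscript circle in the literature;
  \<open>rel_set\<close> unfolds to exactly its two back-and-forth clauses.\<close>
definition lift :: "('w \<times> 'w) set \<Rightarrow> 'w set \<Rightarrow> 'w set \<Rightarrow> bool" where
  "lift R t s \<longleftrightarrow> rel_set (\<lambda>w v. (w, v) \<in> R) t s"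

definition below :: "('w set \<Rightarrow> 'w set \<Rightarrow> 'w set) \<Rightarrow> 'w set \<Rightarrow> 'w set \<Rightarrow> bool" where
  "below J t s \<longleftrightarrow> J t s = s"

text \<open>The composition of the converse of \<open>below\<close> with \<open>lift\<close>: first pass to a smaller team,
  then move along \<open>R\<close>.\<close>

definition below_lift ::
  "'w set \<Rightarrow> ('w \<times> 'w) set \<Rightarrow> ('w set \<Rightarrow> 'w set \<Rightarrow> 'w set) \<Rightarrow> 'w set \<Rightarrow> 'w set \<Rightarrow> bool" where
  "below_lift W R J t s \<longleftrightarrow> (\<exists>r\<subseteq>W. below J r t \<and> lift R r s)"

locale team_frame =
  fixes W :: "'w set"
    and R :: "('w \<times> 'w) set"
    and J :: "'w set \<Rightarrow> 'w set \<Rightarrow> 'w set"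
  assumes nonempty: "W \<noteq> {}"
    and order: "partial_order_on W R"
    and closed: "\<lbrakk>t \<subseteq> W; s \<subseteq> W\<rbrakk> \<Longrightarrow> J t s \<subseteq> W"
    and assoc: "\<lbrakk>t \<subseteq> W; s \<subseteq> W; r \<subseteq> W\<rbrakk> \<Longrightarrow> J (J t s) r = J t (J s r)"
    and commute: "\<lbrakk>t \<subseteq> W; s \<subseteq> W\<rbrakk> \<Longrightarrow> J t s = J s t"
    and idem: "t \<subseteq> W \<Longrightarrow> J t t = t"
    and empty_neutral: "t \<subseteq> W \<Longrightarrow> J {} t = t"
    and lift_below: "\<lbrakk>t \<subseteq> W; s \<subseteq> W; s' \<subseteq> W; lift R t s; below J s' s\<rbrakk>
      \<Longrightarrow> \<exists>t'\<subseteq>W. below J t' t \<and> lift R t' s'"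
    and below_lift_image: "\<lbrakk>t \<subseteq> W; s \<subseteq> W; below_lift W R J t s\<rbrakk> \<Longrightarrow> below J s (R `` t)"
    and image_join: "\<lbrakk>t \<subseteq> W; s \<subseteq> W\<rbrakk> \<Longrightarrow> J (R `` t) (R `` s) = R `` (J t s)"

locale distributive_team_frame = team_frame +
  assumes distrib: "\<lbrakk>t \<subseteq> W; r \<subseteq> W; s \<subseteq> W; below J t (J r s)\<rbrakk>
      \<Longrightarrow> \<exists>r'\<subseteq>W. \<exists>s'\<subseteq>W. below J r' r \<and> below J s' s \<and> t = J r' s'"

definition valuation :: "'w set \<Rightarrow> ('w \<times> 'w) set \<Rightarrow> ('p \<Rightarrow> 'w set) \<Rightarrow> bool" where
  "valuation W R V \<longleftrightarrow>
    (\<forall>p. V p \<subseteq> W) \<and> (\<forall>p w v. w \<in> V p \<longrightarrow> (w, v) \<in> R \<longrightarrow> v \<in> V p)"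

primrec sat ::
  "'w set \<Rightarrow> ('w \<times> 'w) set \<Rightarrow> ('w set \<Rightarrow> 'w set \<Rightarrow> 'w set) \<Rightarrow> ('p \<Rightarrow> 'w set)
    \<Rightarrow> 'w set \<Rightarrow> 'p form \<Rightarrow> bool" where
  "sat W R J V t (Atom p) \<longleftrightarrow> below J t (V p)"
| "sat W R J V t Falsum \<longleftrightarrow> t = {}"
| "sat W R J V t (\<phi> \<^bold>\<and> \<psi>) \<longleftrightarrow> sat W R J V t \<phi> \<and> sat W R J V t \<psi>"
| "sat W R J V t (\<phi> \<^bold>\<or> \<psi>) \<longleftrightarrow>
    (\<exists>s\<subseteq>W. \<exists>r\<subseteq>W. below J t (J s r) \<and> sat W R J V s \<phi> \<and> sat W R J V r \<psi>)"
| "sat W R J V t (\<phi> \<squnion> \<psi>) \<longleftrightarrow> sat W R J V t \<phi> \<or> sat W R J V t \<psi>"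
| "sat W R J V t (\<phi> \<^bold>\<rightarrow> \<psi>) \<longleftrightarrow>
    (\<forall>s\<subseteq>W. below_lift W R J t s \<longrightarrow> sat W R J V s \<phi> \<longrightarrow> sat W R J V s \<psi>)"

definition valid ::
  "'w set \<Rightarrow> ('w \<times> 'w) set \<Rightarrow> ('w set \<Rightarrow> 'w set \<Rightarrow> 'w set) \<Rightarrow> 'p form \<Rightarrow> bool" where
  "valid W R J \<phi> \<longleftrightarrow> (\<forall>V. valuation W R V \<longrightarrow> (\<forall>t\<subseteq>W. sat W R J V t \<phi>))"

end

theory Submission
  imports Defs
begin

text \<open>
  Satisfaction is persistent along \<open>\<succcurlyeq>\<circ>R\<degree>\<close> for all formulas, and by distributivity the teams
  satisfying a standard formula are closed under the join. For an implication, a team reachable from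
  \<open>J t s\<close> splits into a part reachable from \<open>t\<close> and a part reachable from \<open>s\<close>; the same splitting
  then yields both validities.
\<close>

lemma lift_trans:
  assumes "trans R" "lift R t s" "lift R s u"
  shows "lift R t u"
  using assms unfolding lift_def rel_set_def by (meson transD)

context team_frame
begin

lemma relation_props: "R \<subseteq> W \<times> W" "refl_on W R" "trans R"
  using order unfolding partial_order_on_def preorder_on_def by auto

lemma image_subset: "R `` t \<subseteq> W"
  using relation_props(1) by auto

lemma lift_image: "t \<subseteq> W \<Longrightarrow> lift R t (R `` t)"
  using relation_props(2) unfolding lift_def rel_set_def refl_on_def by blast

lemma lift_self: "t \<subseteq> W \<Longrightarrow> lift R t t"
  using relation_props(2) unfolding lift_def rel_set_def refl_on_def by blast

lemma below_refl: "t \<subseteq> W \<Longrightarrow> below J t t"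
  by (simp add: below_def idem)

lemma below_trans:
  assumes "t \<subseteq> W" "s \<subseteq> W" "u \<subseteq> W" "below J t s" "below J s u"
  shows "below J t u"
  using assoc[OF assms(1-3)] assms(4,5) by (simp add: below_def)

lemma below_joinI1: "\<lbrakk>t \<subseteq> W; s \<subseteq> W\<rbrakk> \<Longrightarrow> below J t (J t s)"
  using assoc[of t t s] by (simp add: below_def idem)

lemma below_joinI2: "\<lbrakk>t \<subseteq> W; s \<subseteq> W\<rbrakk> \<Longrightarrow> below J s (J t s)"
  using below_joinI1[of s t] by (simp add: commute)

lemma join_least:
  "\<lbrakk>t \<subseteq> W; s \<subseteq> W; u \<subseteq> W; below J t u; below J s u\<rbrakk> \<Longrightarrow> below J (J t s) u"
  by (simp add: below_def assoc)

lemma join_mono: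
  assumes "t \<subseteq> W" "s \<subseteq> W" "t' \<subseteq> W" "s' \<subseteq> W" "below J t t'" "below J s s'"
  shows "below J (J t s) (J t' s')"
  using join_least[OF assms(1,2) closed[OF assms(3,4)]
      below_trans[OF assms(1,3) closed[OF assms(3,4)] assms(5) below_joinI1[OF assms(3,4)]]
      below_trans[OF assms(2,4) closed[OF assms(3,4)] assms(6) below_joinI2[OF assms(3,4)]]] .

text \<open>Needed where two local disjunctions are joined: it regroups the four witnesses by
  disjunct.\<close>

lemma join_interchange:
  assumes "a \<subseteq> W" "b \<subseteq> W" "c \<subseteq> W" "d \<subseteq> W"
  shows "J (J a b) (J c d) = J (J a c) (J b d)"
proof -
  have "J (J a b) (J c d) = J a (J (J b c) d)"
    using assms by (simp add: assoc closed)
  also have "\<dots> = J a (J (J c b) d)"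
    using assms by (simp only: commute[of b c])
  also have "\<dots> = J (J a c) (J b d)"
    using assms by (simp add: assoc closed)
  finally show ?thesis .
qed

lemma below_empty: "t \<subseteq> W \<Longrightarrow> below J t {} \<Longrightarrow> t = {}"
  using commute[of t "{}"] empty_neutral[of t] by (simp add: below_def)

lemma below_lift_of_below: "\<lbrakk>s \<subseteq> W; below J s t\<rbrakk> \<Longrightarrow> below_lift W R J t s"
  unfolding below_lift_def using lift_self by blast

lemma below_lift_image_self: "t \<subseteq> W \<Longrightarrow> below_lift W R J t (R `` t)"
  unfolding below_lift_def using lift_image below_refl by blast

text \<open>The two-step path alternates down, along, down, along. Axiom \<open>lift_below\<close>
  swaps the middle "along, down" into "down, along", after which transitivity of
  \<open>below\<close> and of \<open>lift\<close> merges equal steps.\<close>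

lemma below_lift_trans:
  assumes "t \<subseteq> W" "s \<subseteq> W" "u \<subseteq> W" "below_lift W R J t s" "below_lift W R J s u"
  shows "below_lift W R J t u"
proof -
  obtain r where r: "r \<subseteq> W" "below J r t" "lift R r s"
    using assms(4) unfolding below_lift_def by blast
  obtain s' where s': "s' \<subseteq> W" "below J s' s" "lift R s' u"
    using assms(5) unfolding below_lift_def by blast
  obtain r' where r': "r' \<subseteq> W" "below J r' r" "lift R r' s'"
    using lift_below[OF r(1) assms(2) s'(1) r(3) s'(2)] by blast
  have "below J r' t" "lift R r' u"
    using below_trans[OF r'(1) r(1) assms(1) r'(2) r(2)]
      lift_trans[OF relation_props(3) r'(3) s'(3)] by auto
  with r'(1) show ?thesis unfolding below_lift_def by blast
qed

lemma image_valuation: "valuation W R V \<Longrightarrow> R `` V p = V p"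
  using relation_props(2) unfolding valuation_def refl_on_def Image_def by blast

text \<open>Induction on the formula. Implications need only that reachability composes; atoms and
  local disjunctions need a bound on reachable teams, which \<open>below_lift_image\<close>
  supplies.\<close>

lemma sat_persistent:
  assumes V: "valuation W R V"
  shows "\<lbrakk>t \<subseteq> W; s \<subseteq> W; below_lift W R J t s; sat W R J V t \<phi>\<rbrakk> \<Longrightarrow> sat W R J V s \<phi>"
proof (induction \<phi> arbitrary: t s)
  case (Atom p)
  have Vp: "V p \<subseteq> W" using V by (simp add: valuation_def)
  \<comment> \<open>Taking \<open>V p\<close> as the starting team makes the bound on
    \<open>s\<close> the image of \<open>V p\<close>, which is \<open>V p\<close> again by
    persistence of the valuation.\<close>
  have "below_lift W R J (V p) t"
    using below_lift_of_below[OF Atom.prems(1)] Atom.prems(4) by simp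
  then have "below_lift W R J (V p) s"
    using below_lift_trans[OF Vp Atom.prems(1,2)] Atom.prems(3) by blast
  then show ?case
    using below_lift_image[OF Vp Atom.prems(2)] image_valuation[OF V] by simp
next
  case Falsum
  then obtain r where r: "r \<subseteq> W" "below J r {}" "lift R r s"
    unfolding below_lift_def by auto
  then have "r = {}" using below_empty by blast
  with r(3) show ?case by (auto simp: lift_def rel_set_def)
next
  case (LDisj \<phi> \<psi>)
  from LDisj.prems(4) obtain a b where ab: "a \<subseteq> W" "b \<subseteq> W" "below J t (J a b)"
    and sat: "sat W R J V a \<phi>" "sat W R J V b \<psi>" by auto
  have "below_lift W R J (J a b) s"
    using below_lift_trans[OF closed[OF ab(1,2)] LDisj.prems(1,2)
        below_lift_of_below[OF LDisj.prems(1) ab(3)] LDisj.prems(3)] .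
  \<comment> \<open>The images of \<open>a\<close> and \<open>b\<close> are the new witnesses: by
    \<open>image_join\<close> their join is the image of \<open>J a b\<close>, which bounds
    \<open>s\<close>.\<close>
  then have "below J s (J (R `` a) (R `` b))"
    using below_lift_image[OF closed[OF ab(1,2)] LDisj.prems(2)] image_join[OF ab(1,2)] by simp
  moreover have "sat W R J V (R `` a) \<phi>" "sat W R J V (R `` b) \<psi>"
    using LDisj.IH(1)[OF ab(1) image_subset below_lift_image_self[OF ab(1)] sat(1)]
      LDisj.IH(2)[OF ab(2) image_subset below_lift_image_self[OF ab(2)] sat(2)] .
  ultimately show ?case using image_subset unfolding sat.simps(4) by blast
next
  case (Imp \<phi> \<psi>)
  have "below_lift W R J t u" if "u \<subseteq> W" "below_lift W R J s u" for u
    using below_lift_trans[OF Imp.prems(1,2) that(1) Imp.prems(3) that(2)] .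
  with Imp.prems(4) show ?case by simp
qed auto

text \<open>Downward closure is the instance of persistence in which the step along \<open>R\<close>
  is reflexive.\<close>

lemma sat_below:
  "\<lbrakk>valuation W R V; t \<subseteq> W; s \<subseteq> W; below J s t; sat W R J V t \<phi>\<rbrakk> \<Longrightarrow> sat W R J V s \<phi>"
  using sat_persistent below_lift_of_below by blast

end

context distributive_team_frame
begin

text \<open>The image of \<open>J t s\<close> bounds \<open>u\<close> and is the join of the images
  of \<open>t\<close> and \<open>s\<close>, so distributivity splits \<open>u\<close> into a part
  below each image. Each image is reachable from its own team, hence so is the part below
  it.\<close>

lemma below_lift_joinE:
  assumes "t \<subseteq> W" "s \<subseteq> W" "u \<subseteq> W" "below_lift W R J (J t s) u"
  obtains u1 u2 where "u1 \<subseteq> W" "u2 \<subseteq> W" "u = J u1 u2"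
    "below_lift W R J t u1" "below_lift W R J s u2"
proof -
  have "below J u (J (R `` t) (R `` s))"
    using below_lift_image[OF closed[OF assms(1,2)] assms(3,4)] image_join[OF assms(1,2)]
    by simp
  from distrib[OF assms(3) image_subset image_subset this]
  obtain u1 u2 where u: "u1 \<subseteq> W" "u2 \<subseteq> W" "u = J u1 u2"
    "below J u1 (R `` t)" "below J u2 (R `` s)"
    by (elim exE conjE)
  have "below_lift W R J t u1" "below_lift W R J s u2"
    using below_lift_trans[OF assms(1) image_subset u(1) below_lift_image_self[OF assms(1)]
        below_lift_of_below[OF u(1,4)]]
      below_lift_trans[OF assms(2) image_subset u(2) below_lift_image_self[OF assms(2)]
        below_lift_of_below[OF u(2,5)]] .
  then show thesis by (rule that[OF u(1-3)])
qed

text \<open>Induction on the formula; implication is the one case that calls on distributivity,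
  through \<open>below_lift_joinE\<close>.\<close>

lemma standard_sat_join:
  assumes V: "valuation W R V"
  shows "\<lbrakk>standard \<alpha>; t \<subseteq> W; s \<subseteq> W; sat W R J V t \<alpha>; sat W R J V s \<alpha>\<rbrakk>
    \<Longrightarrow> sat W R J V (J t s) \<alpha>"
proof (induction \<alpha> arbitrary: t s)
  case (Atom p)
  then show ?case using V join_least by (simp add: valuation_def)
next
  case Falsum
  then show ?case using empty_neutral by auto
next
  case (LDisj \<phi> \<psi>)
  obtain a b where ab: "a \<subseteq> W" "b \<subseteq> W" "below J t (J a b)"
    "sat W R J V a \<phi>" "sat W R J V b \<psi>" using LDisj.prems(4) by auto
  obtain c d where cd: "c \<subseteq> W" "d \<subseteq> W" "below J s (J c d)"
    "sat W R J V c \<phi>" "sat W R J V d \<psi>" using LDisj.prems(5) by auto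
  have "below J (J t s) (J (J a c) (J b d))"
    using join_mono[OF LDisj.prems(2,3) closed[OF ab(1,2)] closed[OF cd(1,2)] ab(3) cd(3)]
      join_interchange[OF ab(1,2) cd(1,2)] by simp
  moreover have "sat W R J V (J a c) \<phi>" "sat W R J V (J b d) \<psi>"
    using LDisj ab cd by auto
  ultimately show ?case
    using closed[OF ab(1) cd(1)] closed[OF ab(2) cd(2)] unfolding sat.simps(4) by blast
next
  case (Imp \<phi> \<psi>)
  have "sat W R J V u \<psi>"
    if u: "u \<subseteq> W" "below_lift W R J (J t s) u" "sat W R J V u \<phi>" for u
  proof -
    obtain u1 u2 where u12: "u1 \<subseteq> W" "u2 \<subseteq> W" "u = J u1 u2"
      "below_lift W R J t u1" "below_lift W R J s u2"
      using below_lift_joinE[OF Imp.prems(2,3) u(1,2)] .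
    \<comment> \<open>Both parts lie below \<open>u\<close>, so the antecedent passes down to them.
      The implications at \<open>t\<close> and \<open>s\<close> then apply separately, and the
      induction hypothesis for \<open>\<psi>\<close> rejoins the parts.\<close>
    have "sat W R J V u1 \<phi>" "sat W R J V u2 \<phi>"
      using sat_below[OF V u(1) u12(1) _ u(3)] sat_below[OF V u(1) u12(2) _ u(3)]
        below_joinI1[OF u12(1,2)] below_joinI2[OF u12(1,2)] u12(3) by simp_all
    then have "sat W R J V u1 \<psi>" "sat W R J V u2 \<psi>"
      using Imp.prems u12 by auto
    then show ?thesis using Imp u12 by auto
  qed
  then show ?case by simp
\<comment> \<open>Conjunction follows from the induction hypotheses; global disjunction is vacuous
  because it is never standard.\<close>
qed auto

text \<open>A team satisfying the antecedent lies below a join of two teams satisfying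
  \<open>\<alpha>\<close>; closure under joins and then downward closure give
  \<open>\<alpha>\<close> there.\<close>

lemma valid_standard_disj_idem:
  assumes "standard \<alpha>"
  shows "valid W R J (\<alpha> \<^bold>\<or> \<alpha> \<^bold>\<rightarrow> \<alpha>)"
proof -
  have "sat W R J V s \<alpha>"
    if V: "valuation W R V" and s: "s \<subseteq> W" and sat_s: "sat W R J V s (\<alpha> \<^bold>\<or> \<alpha>)" for V s
  proof -
    obtain a b where ab: "a \<subseteq> W" "b \<subseteq> W" "below J s (J a b)"
      "sat W R J V a \<alpha>" "sat W R J V b \<alpha>" using sat_s by auto
    show ?thesis
      using sat_below[OF V closed[OF ab(1,2)] s ab(3)
          standard_sat_join[OF V assms ab(1,2,4,5)]] .
  qed
  then show ?thesis unfolding valid_def sat.simps(6) by blast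
qed

lemma valid_standard_disj_elim:
  assumes "standard \<alpha>"
  shows "valid W R J ((\<phi> \<^bold>\<rightarrow> \<alpha>) \<^bold>\<rightarrow> ((\<psi> \<^bold>\<rightarrow> \<alpha>) \<^bold>\<rightarrow> (\<phi> \<^bold>\<or> \<psi> \<^bold>\<rightarrow> \<alpha>)))"
proof -
  have "sat W R J V w \<alpha>"
    if V: "valuation W R V" and sub: "u \<subseteq> W" "v \<subseteq> W" "w \<subseteq> W"
      and sat_u: "sat W R J V u (\<phi> \<^bold>\<rightarrow> \<alpha>)" and uv: "below_lift W R J u v"
      and sat_v: "sat W R J V v (\<psi> \<^bold>\<rightarrow> \<alpha>)" and vw: "below_lift W R J v w"
      and sat_w: "sat W R J V w (\<phi> \<^bold>\<or> \<psi>)" for V u v w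
  proof -
    \<comment> \<open>Persistence brings both implications to the same team \<open>w\<close>, where
      the disjunction is evaluated.\<close>
    have imp: "sat W R J V w (\<phi> \<^bold>\<rightarrow> \<alpha>)" "sat W R J V w (\<psi> \<^bold>\<rightarrow> \<alpha>)"
      using sat_persistent[OF V sub(2,3) vw sat_persistent[OF V sub(1,2) uv sat_u]]
        sat_persistent[OF V sub(2,3) vw sat_v] .
    obtain a b where ab: "a \<subseteq> W" "b \<subseteq> W" "below J w (J a b)"
      "sat W R J V a \<phi>" "sat W R J V b \<psi>" using sat_w by auto
    \<comment> \<open>The witnesses \<open>a\<close> and \<open>b\<close> may fail to be reachable
      from \<open>w\<close>, so the implications cannot be used on them. Distributivity shrinks them
      to parts whose join is exactly \<open>w\<close>; these lie below \<open>w\<close> and are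
      therefore reachable.\<close>
    obtain a' b' where ab': "a' \<subseteq> W" "b' \<subseteq> W" "w = J a' b'" "below J a' a" "below J b' b"
      using distrib[OF sub(3) ab(1-3)] by (elim exE conjE)
    have "sat W R J V a' \<phi>" "sat W R J V b' \<psi>"
      using sat_below[OF V ab(1) ab'(1,4) ab(4)] sat_below[OF V ab(2) ab'(2,5) ab(5)] .
    moreover have "below_lift W R J w a'" "below_lift W R J w b'"
      using ab' below_lift_of_below below_joinI1 below_joinI2 by auto
    ultimately have "sat W R J V a' \<alpha>" "sat W R J V b' \<alpha>"
      using imp ab' by auto
    then show ?thesis using standard_sat_join[OF V assms ab'(1,2)] ab'(3) by simp
  qed
  then show ?thesis
    unfolding valid_def by (intro allI impI sat.simps(6)[THEN iffD2])
qed

end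

theorem corollary4p28:
  fixes W :: "'w set"
    and R :: "('w \<times> 'w) set"
    and J :: "'w set \<Rightarrow> 'w set \<Rightarrow> 'w set"
    and \<alpha> \<phi> \<psi> :: "'p form"
  assumes "distributive_team_frame W R J"
    and "standard \<alpha>"
  shows "valid W R J (\<alpha> \<^bold>\<or> \<alpha> \<^bold>\<rightarrow> \<alpha>)
    \<and> valid W R J ((\<phi> \<^bold>\<rightarrow> \<alpha>) \<^bold>\<rightarrow> ((\<psi> \<^bold>\<rightarrow> \<alpha>) \<^bold>\<rightarrow> (\<phi> \<^bold>\<or> \<psi> \<^bold>\<rightarrow> \<alpha>)))"
proof -
  interpret distributive_team_frame W R J by fact
  show ?thesis
    using valid_standard_disj_idem valid_standard_disj_elim assms(2) by blast
qed

end
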